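(* Let $q$ be a prime power, let $d \le n$ be positive integers and $k = d-1$. Let $\mathcal{F}=\{F_1,\dots,F_t\}$ be a family of linear cellular automata $F_1,\dots,F_t : \mathbb{F}_q^n \to \mathbb{F}_q^{n-k}$ defined by linear local rules $f_1,\dots,f_t : \mathbb{F}_q^d\to\mathbb{F}_q$ of diameter $d$, each having nonzero first coefficient and last coefficient equal to $1$. Then the subspace code $\mathcal{C}_{\mathcal{F}} = \{\ker(F_i) : 1 \le i \le t\}$ is a Grassmannian code, that is, $\mathcal{C}_{\mathcal{F}} \subseteq Gr(\mathbb{F}_q^n, k)$.
   Context: $\mathbb{F}_q$ is the finite field with $q$ elements. A cellular automaton (CA) of length $n$, diameter $d$ (with $d\le n$, $k=d-1$) and local rule $f:\mathbb{F}_q^d\to\mathbb{F}_q$ is the map $F:\mathbb{F}_q^n \to \mathbb{F}_q^{n-k}$ given by $F(x_0,\dots,x_{n-1})_i = f(x_i,\dots,x_{i+k})$ for $0\le i\le n-k-1$. The CA is linear if $f(x_0,\dots,x_k)=a_0x_0+\cdots+a_kx_k$ with $a_i\in\mathbb{F}_q$. Standing assumption: $a_0\neq 0$ and $a_k=1$ (so the rule is bipermutive). $Gr(\mathbb{F}_q^n,k)$ denotes the set of all $k$-dimensional subspaces of $\mathbb{F}_q^n$; a subspace code is a set of subspaces of $\mathbb{F}_q^n$. *)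

theory Defs
  imports "Jordan_Normal_Form.VS_Connect"
begin

text \<open>Vectors of length \<open>n\<close> over a finite field are the elements of \<^term>\<open>carrier_vec n\<close>,
  indexed from 0. The constants \<open>subspace\<close> and \<open>vectorspace.dim\<close> are those of
  the VectorSpace development, hence the explicit scalar ring \<^term>\<open>class_ring\<close>.\<close>

definition cellular_automaton ::
    "nat \<Rightarrow> nat \<Rightarrow> ('a vec \<Rightarrow> 'a) \<Rightarrow> 'a vec \<Rightarrow> 'a vec" where
  "cellular_automaton n d f x =
     vec (n - (d - 1)) (\<lambda>i. f (vec d (\<lambda>j. x $ (i + j))))"

definition linear_local_rule ::
    "nat \<Rightarrow> 'a::field vec \<Rightarrow> ('a vec \<Rightarrow> 'a) \<Rightarrow> bool" where
  "linear_local_rule d a f \<longleftrightarrow>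
     a \<in> carrier_vec d \<and> (\<forall>x \<in> carrier_vec d. f x = (\<Sum>j<d. a $ j * x $ j))"

text \<open>The set below is \<open>mod_hom.ker\<close> for maps between vector spaces of lengths
  \<open>n\<close> and \<open>m\<close>, written out so that it does not presuppose linearity of \<open>F\<close>.\<close>

definition vec_ker :: "nat \<Rightarrow> nat \<Rightarrow> ('a::field vec \<Rightarrow> 'a vec) \<Rightarrow> 'a vec set" where
  "vec_ker n m F = {x \<in> carrier_vec n. F x = 0\<^sub>v m}"

definition Gr :: "nat \<Rightarrow> nat \<Rightarrow> 'a::field vec set set" where
  "Gr n k = {W. VectorSpace.subspace class_ring W (module_vec TYPE('a) n) \<and>
     vectorspace.dim class_ring (module_vec TYPE('a) n\<lparr>carrier := W\<rparr>) = k}"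

end

theory Submission
  imports Defs
begin

text \<open>A linear cellular automaton is a linear map, so by rank-nullity its kernel has dimension
  \<open>k\<close> as soon as it is surjective. Since the last coefficient is nonzero, every output can be
  prescribed: choose the first \<open>k\<close> cells arbitrarily and solve the \<open>i\<close>-th equation for
  cell \<open>i + k\<close>.\<close>

text \<open>Induction on the number of equations: equations with index below \<open>m\<close> read
  only cells below \<open>m + k\<close>, so cell \<open>m + k\<close> is still free when equation
  \<open>m\<close> is added. Letting \<open>g\<close> range over functions on all naturals avoids
  tracking a length in the induction.\<close>

lemma linear_recurrence_solvable:
  fixes c y :: "nat \<Rightarrow> 'a::field"
  assumes "c k \<noteq> 0"
  shows "\<exists>g. \<forall>i<m. (\<Sum>j\<le>k. c j * g (i + j)) = y i"
proof (induction m)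
  case 0
  show ?case by simp
next
  case (Suc m)
  then obtain g where g: "\<And>i. i < m \<Longrightarrow> (\<Sum>j\<le>k. c j * g (i + j)) = y i"
    by blast
  define s where "s = (\<Sum>j<k. c j * g (m + j))"
  \<comment> \<open>The new value solves \<open>s + c k * z = y m\<close> for \<open>z\<close>;
    dividing by \<open>c k\<close> is where \<open>c k \<noteq> 0\<close> enters.\<close>
  define h where "h = g(m + k := (y m - s) / c k)"
  have "(\<Sum>j\<le>k. c j * h (i + j)) = y i" if "i < Suc m" for i
  proof (cases "i = m")
    case True
    have "(\<Sum>j<k. c j * h (m + j)) = s"
      unfolding s_def h_def by (rule sum.cong) auto
    moreover have "c k * h (m + k) = y m - s"
      using assms by (simp add: h_def)
    ultimately show ?thesis
      using True by (simp flip: lessThan_Suc_atMost)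
  next
    case False
    with that have "i < m" by simp
    then have "(\<Sum>j\<le>k. c j * h (i + j)) = (\<Sum>j\<le>k. c j * g (i + j))"
      unfolding h_def by (intro sum.cong) auto
    with g \<open>i < m\<close> show ?thesis by simp
  qed
  then show ?case by blast
qed

lemma cellular_automaton_index:
  assumes "linear_local_rule d a f" and "i < n - (d - 1)"
  shows "cellular_automaton n d f x $ i = (\<Sum>j<d. a $ j * x $ (i + j))"
  using assms by (simp add: cellular_automaton_def linear_local_rule_def)

lemma cellular_automaton_carrier:
  "cellular_automaton n d f x \<in> carrier_vec (n - (d - 1))"
  by (simp add: cellular_automaton_def)

text \<open>Each output entry is a fixed linear form in a window of the input. From
  \<open>i < n - (d - 1)\<close> and \<open>j < d\<close> follows \<open>i + j < n\<close>, so the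
  window lies inside the vector and entries of sums and scalar multiples can be split there.\<close>

lemma linear_map_cellular_automaton:
  fixes a :: "'a::field vec"
  assumes "0 < d" and "d \<le> n" and rule: "linear_local_rule d a f"
  shows "linear_map class_ring (module_vec TYPE('a) n) (module_vec TYPE('a) (n - (d - 1)))
    (cellular_automaton n d f)"
proof -
  have "cellular_automaton n d f (x + y) = cellular_automaton n d f x + cellular_automaton n d f y"
    if "x \<in> carrier_vec n" "y \<in> carrier_vec n" for x y
    using that assms cellular_automaton_carrier[of n d f]
    by (intro eq_vecI)
      (auto simp: cellular_automaton_index[OF rule] distrib_left sum.distrib
        carrier_vecD[OF cellular_automaton_carrier])
  moreover have "cellular_automaton n d f (r \<cdot>\<^sub>v x) = r \<cdot>\<^sub>v cellular_automaton n d f x"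
    if "x \<in> carrier_vec n" for r x
    using that assms
    by (intro eq_vecI)
      (auto simp: cellular_automaton_index[OF rule] sum_distrib_left ac_simps
        carrier_vecD[OF cellular_automaton_carrier])
  ultimately show ?thesis
    using vec_vs vec_module cellular_automaton_carrier[of n d f]
    by (auto simp: linear_map_def mod_hom_def mod_hom_axioms_def
        LinearCombinations.module_hom_def module_vec_simps class_ring_simps)
qed

lemma cellular_automaton_surj:
  assumes "0 < d" and "d \<le> n" and rule: "linear_local_rule d a f" and "a $ (d - 1) \<noteq> 0"
  shows "cellular_automaton n d f ` carrier_vec n = carrier_vec (n - (d - 1))"
proof
  show "carrier_vec (n - (d - 1)) \<subseteq> cellular_automaton n d f ` carrier_vec n"
  proof
    fix y :: "'a vec"
    assume y: "y \<in> carrier_vec (n - (d - 1))"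
    \<comment> \<open>The recurrence sums over \<open>j \<le> k\<close>, the rule over
      \<open>j < d\<close>. With \<open>k = d - 1\<close> the ranges agree for positive
      \<open>d\<close>; at \<open>d = 0\<close> truncated subtraction would leave the index
      0.\<close>
    have "{..d - 1} = {..<d}"
      using \<open>0 < d\<close> by auto
    with linear_recurrence_solvable[of "($) a" "d - 1" "n - (d - 1)" "($) y"] assms(4)
    obtain g where g: "\<And>i. i < n - (d - 1) \<Longrightarrow> (\<Sum>j<d. a $ j * g (i + j)) = y $ i"
      by auto
    \<comment> \<open>Truncating \<open>g\<close> to \<open>n\<close> cells loses nothing: the last
      equation, \<open>i = n - d\<close>, reads up to cell \<open>n - 1\<close>.\<close>
    have "cellular_automaton n d f (vec n g) = y"
      using y assms(1,2) g
      by (intro eq_vecI)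
        (auto simp: cellular_automaton_index[OF rule] carrier_vecD[OF cellular_automaton_carrier])
    then show "y \<in> cellular_automaton n d f ` carrier_vec n"
      by (metis image_eqI vec_carrier)
  qed
qed (use cellular_automaton_carrier in blast)

lemma vec_ker_cellular_automaton_in_Gr:
  fixes a :: "'a::field vec"
  assumes "0 < d" and "d \<le> n" and "linear_local_rule d a f" and "a $ (d - 1) \<noteq> 0"
  shows "vec_ker n (n - (d - 1)) (cellular_automaton n d f) \<in> Gr n (d - 1)"
proof -
  let ?V = "module_vec TYPE('a) n" and ?W = "module_vec TYPE('a) (n - (d - 1))"
  interpret lm: linear_map class_ring ?V ?W "cellular_automaton n d f"
    using assms by (intro linear_map_cellular_automaton)
  interpret V: vec_space "TYPE('a)" n .
  interpret W: vec_space "TYPE('a)" "n - (d - 1)" .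
  have ker: "lm.ker = vec_ker n (n - (d - 1)) (cellular_automaton n d f)"
    by (simp only: lm.ker_def vec_ker_def module_vec_simps)
  have "lm.im = carrier ?W"
    using cellular_automaton_surj[OF assms] by (simp only: lm.im_def module_vec_simps)
  \<comment> \<open>Rank-nullity measures the image as a space of its own; surjectivity makes it all
    of \<open>?W\<close>, so the rank is \<open>n - (d - 1)\<close>.\<close>
  then have "?W\<lparr>carrier := lm.im\<rparr> = ?W"
    by (simp only: lm.W.carrier_vs_is_self) simp
  then have "(n - (d - 1)) + vectorspace.dim class_ring (?V\<lparr>carrier := lm.ker\<rparr>) = n"
    using lm.rank_nullity[OF V.fin_dim] V.dim_is_n W.dim_is_n by (simp only:)
  then have "vectorspace.dim class_ring (?V\<lparr>carrier := lm.ker\<rparr>) = d - 1"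
    using assms(1,2) by linarith
  with lm.kerT_is_subspace show ?thesis
    unfolding Gr_def ker by blast
qed

theorem lemma2:
  fixes n d k t :: nat
    and a :: "nat \<Rightarrow> 'a::{field,finite} vec"
    and f :: "nat \<Rightarrow> 'a vec \<Rightarrow> 'a"
    and F :: "nat \<Rightarrow> 'a vec \<Rightarrow> 'a vec"
  assumes "0 < d" and "d \<le> n" and "k = d - 1"
    and "\<And>i. i \<in> {1..t} \<Longrightarrow> linear_local_rule d (a i) (f i)"
    and "\<And>i. i \<in> {1..t} \<Longrightarrow> a i $ 0 \<noteq> 0"
    and "\<And>i. i \<in> {1..t} \<Longrightarrow> a i $ k = 1"
    and "\<And>i. i \<in> {1..t} \<Longrightarrow> F i = cellular_automaton n d (f i)"
  shows "{vec_ker n (n - k) (F i) | i. i \<in> {1..t}} \<subseteq> Gr n k"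
proof
  fix W
  assume "W \<in> {vec_ker n (n - k) (F i) | i. i \<in> {1..t}}"
  then obtain i where i: "i \<in> {1..t}" and W: "W = vec_ker n (n - k) (F i)"
    by blast
  \<comment> \<open>Right permutivity gives surjectivity: the coefficient at position
    \<open>k = d - 1\<close> is 1, hence nonzero.\<close>
  have "a i $ (d - 1) \<noteq> 0"
    using assms(3) assms(6)[OF i] by simp
  from vec_ker_cellular_automaton_in_Gr[OF assms(1,2) assms(4)[OF i] this]
  show "W \<in> Gr n k"
    by (simp add: W assms(3) assms(7)[OF i])
qed

end
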